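(* The solutions $\mathbf{E}^{t_{end}},\mathbf{H}^{t_{end}}$ of the fully discrete scheme defined in the context have the discrete symplecticity conservation law $$d\mathbf{E}^{t_{end}}\wedge d\mathbf{H}^{t_{end}}=d\mathbf{E}^0\wedge d\mathbf{H}^0,$$ where $$d\mathbf{E}^t\wedge d\mathbf{H}^t=d\mathbf{E}_x^t\wedge d\mathbf{H}_x^t+d\mathbf{E}_y^t\wedge d\mathbf{H}_y^t+d\mathbf{E}_z^t\wedge d\mathbf{H}_z^t.$$
   Context: **Setting.** $\varepsilon,\mu>0$ are constants. The scheme approximates Maxwell's equations $\partial_t\mathbf{H}=-\frac1\mu\mathbf{curl}\,\mathbf{E}$, $\partial_t\mathbf{E}=\frac1\varepsilon\mathbf{curl}\,\mathbf{H}$, $\nabla\cdot(\varepsilon\mathbf{E})=0$, $\nabla\cdot(\varepsilon\mathbf{H})=0$ for $\mathbb{R}^3$-valued $\mathbf{H}=(H_x,H_y,H_z)^\intercal$, $\mathbf{E}=(E_x,E_y,E_z)^\intercal$ on $\Omega\times[0,t_{end}]$, $\Omega=[x_L,x_R]\times[y_L,y_R]\times[z_L,z_R]$, with periodic boundary conditions and given initial values. **Wedge notation.** The scheme defines a linear map $(\mathbf{H}^0,\mathbf{E}^0)\mapsto(\mathbf{H}^t,\mathbf{E}^t)$, so the entries of $\mathbf{E}^t,\mathbf{H}^t$ are functions of the grid initial values $(\mathbf{H}^0,\mathbf{E}^0)$; $d$ is the exterior derivative with respect to $(\mathbf{H}^0,\mathbf{E}^0)$, and for vectors $a,b\in\mathbb{C}^m$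 of functions, $da\wedge db=\sum_{i=1}^m da_i\wedge db_i$. **Grid.** For $w\in\{x,y,z\}$, $N_w$ is a positive even integer, $h_w=(w_R-w_L)/N_w$, $x_j=x_L+(j-1)h_x$, $y_k=y_L+(k-1)h_y$, $z_l=z_L+(l-1)h_z$ for $1\le j\le N_x$, $1\le k\le N_y$, $1\le l\le N_z$. A grid function is identified with the vector in $\mathbb{C}^{N_xN_yN_z}$ whose entry number $N_xN_y(l-1)+N_x(k-1)+j$ is its value at $(x_j,y_k,z_l)$. $I_m$ is the $m\times m$ identity and $\otimes$ the Kronecker product. **Matrices.** $\nu_w=2\pi/(w_R-w_L)$. $\mathcal{F}_{N_w}$ is the DFT matrix with entries $(e^{2\pi\mathrm{i}/N_w})^{-jk}$, $0\le j,k\le N_w-1$, and $\mathcal{F}_{N_w}^{-1}$ its inverse, with entries $\frac1{N_w}(e^{2\pi\mathrm{i}/N_w})^{jk}$. Put $\Omega_w=\nu_w\,\mathrm{diag}(0,1,\ldots,\frac{N_w}2-1,0,-\frac{N_w}2+1,\ldots,-2,-1)$, $\Omega_1=I_{N_z}\otimes I_{N_y}\otimes\Omega_x$, $\Omega_2=I_{N_z}\otimes\Omega_y\otimes I_{N_x}$, $\Omega_3=\Omega_z\otimes I_{N_y}\otimes I_{N_x}$. For $\tau\ge0$ put $\Psi=\tau^2(\Omega_1^2+\Omega_2^2+\Omega_3^2)$ and let $A=\frac{\cosh(\sqrt{-\Psi})-I}{\Psi}$, $B=\frac{\sinh(\sqrt{-\Psi})}{\sqrt{-\Psi}}$ be the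 diagonal matrices obtained entrywise (with the value by continuity, $-1/2$ and $1$ respectively, where the diagonal entry of $\Psi$ is $0$). Define $\mathbf{c}_{11}=I+\tau^2(\Omega_3^2+\Omega_2^2)A$, $\mathbf{c}_{22}=I+\tau^2(\Omega_3^2+\Omega_1^2)A$, $\mathbf{c}_{33}=I+\tau^2(\Omega_2^2+\Omega_1^2)A$, $\mathbf{c}_{12}=-\tau^2\Omega_2\Omega_1A$, $\mathbf{c}_{13}=-\tau^2\Omega_3\Omega_1A$, $\mathbf{c}_{23}=-\tau^2\Omega_3\Omega_2A$, $\mathbf{s}_{12}=\mathrm{i}\tau\Omega_3B$, $\mathbf{s}_{13}=\mathrm{i}\tau\Omega_2B$, $\mathbf{s}_{23}=\mathrm{i}\tau\Omega_1B$. **Fully discrete scheme.** Let $\mathbf{E}^0_w,\mathbf{H}^0_w$ be the (real) vectors of values of $E_w(\cdot,0),H_w(\cdot,0)$ at the grid points, and $\widehat{\mathbf{E}}^0_w=(\mathcal{F}_{N_z}\otimes\mathcal{F}_{N_y}\otimes\mathcal{F}_{N_x})\mathbf{E}^0_w$, $\widehat{\mathbf{H}}^0_w=(\mathcal{F}_{N_z}\otimes\mathcal{F}_{N_y}\otimes\mathcal{F}_{N_x})\mathbf{H}^0_w$. For a time $t\ge0$, with $\tau=t/\sqrt{\mu\varepsilon}$, $$\mathbf{c}=\begin{pmatrix}\mathbf{c}_{11}&\mathbf{c}_{12}&\mathbf{c}_{13}\\\mathbf{c}_{12}&\mathbf{c}_{22}&\mathbf{c}_{23}\\\mathbf{c}_{13}&\mathbf{c}_{23}&\mathbf{c}_{33}\end{pmatrix},\qquad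 \mathbf{s}=\begin{pmatrix}\mathbf{0}&-\mathbf{s}_{12}&\mathbf{s}_{13}\\\mathbf{s}_{12}&\mathbf{0}&-\mathbf{s}_{23}\\-\mathbf{s}_{13}&\mathbf{s}_{23}&\mathbf{0}\end{pmatrix},$$ and $\widehat{\mathbf{E}}=(\widehat{\mathbf{E}}_x,\widehat{\mathbf{E}}_y,\widehat{\mathbf{E}}_z)^\intercal$, $\widehat{\mathbf{H}}=(\widehat{\mathbf{H}}_x,\widehat{\mathbf{H}}_y,\widehat{\mathbf{H}}_z)^\intercal$ (stacked), set $$\sqrt\mu\,\widehat{\mathbf{H}}^{t}=\sqrt\mu\,\mathbf{c}\,\widehat{\mathbf{H}}^0-\sqrt\varepsilon\,\mathbf{s}\,\widehat{\mathbf{E}}^0,\qquad \sqrt\varepsilon\,\widehat{\mathbf{E}}^{t}=\sqrt\varepsilon\,\mathbf{c}\,\widehat{\mathbf{E}}^0+\sqrt\mu\,\mathbf{s}\,\widehat{\mathbf{H}}^0,$$ $\mathbf{E}^{t}_w=(\mathcal{F}^{-1}_{N_z}\otimes\mathcal{F}^{-1}_{N_y}\otimes\mathcal{F}^{-1}_{N_x})\widehat{\mathbf{E}}^{t}_w$, $\mathbf{H}^{t}_w=(\mathcal{F}^{-1}_{N_z}\otimes\mathcal{F}^{-1}_{N_y}\otimes\mathcal{F}^{-1}_{N_x})\widehat{\mathbf{H}}^{t}_w$ for $w=x,y,z$, and $\mathbf{E}^t=(\mathbf{E}^t_x,\mathbf{E}^t_y,\mathbf{E}^t_z)^\intercal$,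 $\mathbf{H}^t=(\mathbf{H}^t_x,\mathbf{H}^t_y,\mathbf{H}^t_z)^\intercal$. The scheme's output is the case $t=t_{end}$. *)

theory Defs
  imports "HOL-Analysis.Derivative" "Jordan_Normal_Form.Matrix"
begin

section \<open>Differential forms on a coordinate space\<close>

text \<open>
  Points and tangent vectors of the \<open>m\<close>-dimensional real coordinate space are the elements of
  \<open>carrier_vec m\<close>. A one-form at a point is a function of one tangent vector, a two-form at a point
  is a function of two. Functions, and hence the forms, are complex valued, the variables are real.
\<close>

definition partial_deriv :: "nat \<Rightarrow> nat \<Rightarrow> (real vec \<Rightarrow> complex) \<Rightarrow> real vec \<Rightarrow> complex" where
  "partial_deriv m k f q =
     vector_derivative (\<lambda>s::real. f (q + s \<cdot>\<^sub>v unit_vec m k)) (at 0)"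

text \<open>\<open>df = \<Sum>\<^sub>k (\<partial>f/\<partial>q\<^sub>k) dq\<^sub>k\<close>, where \<open>dq\<^sub>k(u) = u\<^sub>k\<close>.\<close>

definition ext_deriv ::
  "nat \<Rightarrow> (real vec \<Rightarrow> complex) \<Rightarrow> real vec \<Rightarrow> real vec \<Rightarrow> complex" where
  "ext_deriv m f q u = (\<Sum>k<m. partial_deriv m k f q * of_real (u $ k))"

definition wedge ::
  "(real vec \<Rightarrow> complex) \<Rightarrow> (real vec \<Rightarrow> complex) \<Rightarrow> real vec \<Rightarrow> real vec \<Rightarrow> complex" where
  "wedge \<alpha> \<beta> u v = \<alpha> u * \<beta> v - \<alpha> v * \<beta> u"

text \<open>\<open>da \<and> db = \<Sum>\<^sub>i da\<^sub>i \<and> db\<^sub>i\<close> for vectors \<open>a\<close>, \<open>b\<close> of \<open>n\<close> functions, at the point \<open>q\<close>.\<close>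

definition dwedge ::
  "nat \<Rightarrow> nat \<Rightarrow> (real vec \<Rightarrow> complex vec) \<Rightarrow> (real vec \<Rightarrow> complex vec) \<Rightarrow>
   real vec \<Rightarrow> real vec \<Rightarrow> real vec \<Rightarrow> complex" where
  "dwedge m n a b q u v =
     (\<Sum>i<n. wedge (ext_deriv m (\<lambda>p. a p $ i) q) (ext_deriv m (\<lambda>p. b p $ i) q) u v)"


section \<open>Matrices\<close>

definition kron :: "'a::semiring_1 mat \<Rightarrow> 'a mat \<Rightarrow> 'a mat" (infixr "\<otimes>\<^sub>K" 70) where
  "A \<otimes>\<^sub>K B = mat (dim_row A * dim_row B) (dim_col A * dim_col B)
     (\<lambda>(i, j). A $$ (i div dim_row B, j div dim_col B) * B $$ (i mod dim_row B, j mod dim_col B))"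

text \<open>The matrix whose square blocks of size \<open>n\<close> are given by a list of three rows of length three.\<close>

definition block_mat3 :: "nat \<Rightarrow> 'a mat list list \<Rightarrow> 'a mat" where
  "block_mat3 n M = mat (3 * n) (3 * n)
     (\<lambda>(i, j). (M ! (i div n) ! (j div n)) $$ (i mod n, j mod n))"

text \<open>The block number \<open>w\<close> (from \<open>0\<close>: the \<open>x\<close>, \<open>y\<close> and \<open>z\<close> component) of a stacked vector.\<close>

definition comp3 :: "nat \<Rightarrow> nat \<Rightarrow> 'a vec \<Rightarrow> 'a vec" where
  "comp3 n w a = vec n (\<lambda>i. a $ (w * n + i))"

definition stack3 :: "'a vec \<Rightarrow> 'a vec \<Rightarrow> 'a vec \<Rightarrow> 'a vec" where
  "stack3 a b c = a @\<^sub>v b @\<^sub>v c"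

definition dft_mat :: "nat \<Rightarrow> complex mat" where
  "dft_mat N = mat N N (\<lambda>(j, k). exp (2 * of_real pi * \<i> / of_nat N) powi (- int (j * k)))"

definition inv_dft_mat :: "nat \<Rightarrow> complex mat" where
  "inv_dft_mat N = mat N N (\<lambda>(j, k). 1 / of_nat N * exp (2 * of_real pi * \<i> / of_nat N) ^ (j * k))"

text \<open>\<open>\<nu> diag(0, 1, \<dots>, N/2 - 1, 0, -N/2 + 1, \<dots>, -1)\<close> with \<open>\<nu> = 2\<pi> / (R - L)\<close>.\<close>

definition freq_mat :: "nat \<Rightarrow> real \<Rightarrow> real \<Rightarrow> complex mat" where
  "freq_mat N L R = of_real (2 * pi / (R - L)) \<cdot>\<^sub>m
     mat_diag N (\<lambda>j. if j < N div 2 then of_nat j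
                     else if j = N div 2 then 0
                     else of_int (int j - int N))"


section \<open>The scheme\<close>

record grid3 =
  Nx :: nat
  Ny :: nat
  Nz :: nat
  xL :: real
  xR :: real
  yL :: real
  yR :: real
  zL :: real
  zR :: real

text \<open>
  A grid function is the vector of its \<open>npts G\<close> values with \<open>x\<close> running fastest and \<open>z\<close> slowest.
\<close>

definition npts :: "grid3 \<Rightarrow> nat" where
  "npts G = Nx G * Ny G * Nz G"

definition Dft :: "grid3 \<Rightarrow> complex mat" where
  "Dft G = dft_mat (Nz G) \<otimes>\<^sub>K dft_mat (Ny G) \<otimes>\<^sub>K dft_mat (Nx G)"

definition Inv_Dft :: "grid3 \<Rightarrow> complex mat" where
  "Inv_Dft G = inv_dft_mat (Nz G) \<otimes>\<^sub>K inv_dft_mat (Ny G) \<otimes>\<^sub>K inv_dft_mat (Nx G)"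

definition Om1 :: "grid3 \<Rightarrow> complex mat" where
  "Om1 G = 1\<^sub>m (Nz G) \<otimes>\<^sub>K 1\<^sub>m (Ny G) \<otimes>\<^sub>K freq_mat (Nx G) (xL G) (xR G)"

definition Om2 :: "grid3 \<Rightarrow> complex mat" where
  "Om2 G = 1\<^sub>m (Nz G) \<otimes>\<^sub>K freq_mat (Ny G) (yL G) (yR G) \<otimes>\<^sub>K 1\<^sub>m (Nx G)"

definition Om3 :: "grid3 \<Rightarrow> complex mat" where
  "Om3 G = freq_mat (Nz G) (zL G) (zR G) \<otimes>\<^sub>K 1\<^sub>m (Ny G) \<otimes>\<^sub>K 1\<^sub>m (Nx G)"

definition Psi :: "grid3 \<Rightarrow> real \<Rightarrow> complex mat" where
  "Psi G \<tau> = of_real (\<tau>\<^sup>2) \<cdot>\<^sub>m (Om1 G ^\<^sub>m 2 + Om2 G ^\<^sub>m 2 + Om3 G ^\<^sub>m 2)"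

text \<open>
  \<open>(cosh \<surd>(-\<Psi>) - I) / \<Psi>\<close> and \<open>sinh \<surd>(-\<Psi>) / \<surd>(-\<Psi>)\<close>, entrywise on the diagonal and
  extended by continuity.
\<close>

definition A_mat :: "grid3 \<Rightarrow> real \<Rightarrow> complex mat" where
  "A_mat G \<tau> = mat_diag (npts G) (\<lambda>i. let \<psi> = Psi G \<tau> $$ (i, i) in
     if \<psi> = 0 then - 1 / 2 else (cosh (csqrt (- \<psi>)) - 1) / \<psi>)"

definition B_mat :: "grid3 \<Rightarrow> real \<Rightarrow> complex mat" where
  "B_mat G \<tau> = mat_diag (npts G) (\<lambda>i. let \<psi> = Psi G \<tau> $$ (i, i) in
     if \<psi> = 0 then 1 else sinh (csqrt (- \<psi>)) / csqrt (- \<psi>))"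

definition c11 :: "grid3 \<Rightarrow> real \<Rightarrow> complex mat" where
  "c11 G \<tau> = 1\<^sub>m (npts G) + of_real (\<tau>\<^sup>2) \<cdot>\<^sub>m ((Om3 G ^\<^sub>m 2 + Om2 G ^\<^sub>m 2) * A_mat G \<tau>)"

definition c22 :: "grid3 \<Rightarrow> real \<Rightarrow> complex mat" where
  "c22 G \<tau> = 1\<^sub>m (npts G) + of_real (\<tau>\<^sup>2) \<cdot>\<^sub>m ((Om3 G ^\<^sub>m 2 + Om1 G ^\<^sub>m 2) * A_mat G \<tau>)"

definition c33 :: "grid3 \<Rightarrow> real \<Rightarrow> complex mat" where
  "c33 G \<tau> = 1\<^sub>m (npts G) + of_real (\<tau>\<^sup>2) \<cdot>\<^sub>m ((Om2 G ^\<^sub>m 2 + Om1 G ^\<^sub>m 2) * A_mat G \<tau>)"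

definition c12 :: "grid3 \<Rightarrow> real \<Rightarrow> complex mat" where
  "c12 G \<tau> = - of_real (\<tau>\<^sup>2) \<cdot>\<^sub>m (Om2 G * Om1 G * A_mat G \<tau>)"

definition c13 :: "grid3 \<Rightarrow> real \<Rightarrow> complex mat" where
  "c13 G \<tau> = - of_real (\<tau>\<^sup>2) \<cdot>\<^sub>m (Om3 G * Om1 G * A_mat G \<tau>)"

definition c23 :: "grid3 \<Rightarrow> real \<Rightarrow> complex mat" where
  "c23 G \<tau> = - of_real (\<tau>\<^sup>2) \<cdot>\<^sub>m (Om3 G * Om2 G * A_mat G \<tau>)"

definition s12 :: "grid3 \<Rightarrow> real \<Rightarrow> complex mat" where
  "s12 G \<tau> = (\<i> * of_real \<tau>) \<cdot>\<^sub>m (Om3 G * B_mat G \<tau>)"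

definition s13 :: "grid3 \<Rightarrow> real \<Rightarrow> complex mat" where
  "s13 G \<tau> = (\<i> * of_real \<tau>) \<cdot>\<^sub>m (Om2 G * B_mat G \<tau>)"

definition s23 :: "grid3 \<Rightarrow> real \<Rightarrow> complex mat" where
  "s23 G \<tau> = (\<i> * of_real \<tau>) \<cdot>\<^sub>m (Om1 G * B_mat G \<tau>)"

definition c_mat :: "grid3 \<Rightarrow> real \<Rightarrow> complex mat" where
  "c_mat G \<tau> = block_mat3 (npts G)
     [[c11 G \<tau>, c12 G \<tau>, c13 G \<tau>],
      [c12 G \<tau>, c22 G \<tau>, c23 G \<tau>],
      [c13 G \<tau>, c23 G \<tau>, c33 G \<tau>]]"

definition s_mat :: "grid3 \<Rightarrow> real \<Rightarrow> complex mat" where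
  "s_mat G \<tau> = (let n = npts G; Z = 0\<^sub>m n n in block_mat3 n
     [[Z, - s12 G \<tau>, s13 G \<tau>],
      [s12 G \<tau>, Z, - s23 G \<tau>],
      [- s13 G \<tau>, s23 G \<tau>, Z]])"

text \<open>Application of a transform to each of the three components of a stacked vector.\<close>

definition transform3 :: "complex mat \<Rightarrow> complex vec \<Rightarrow> complex vec" where
  "transform3 F a = (let n = dim_col F in
     stack3 (F *\<^sub>v comp3 n 0 a) (F *\<^sub>v comp3 n 1 a) (F *\<^sub>v comp3 n 2 a))"

text \<open>
  A point \<open>q\<close> of the space of grid initial values is the stacked real vector
  \<open>(H\<^sup>0, E\<^sup>0)\<close> of dimension \<open>phase_dim G\<close>.
\<close>

definition phase_dim :: "grid3 \<Rightarrow> nat" where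
  "phase_dim G = 3 * npts G + 3 * npts G"

definition H_init :: "grid3 \<Rightarrow> real vec \<Rightarrow> complex vec" where
  "H_init G q = map_vec of_real (vec_first q (3 * npts G))"

definition E_init :: "grid3 \<Rightarrow> real vec \<Rightarrow> complex vec" where
  "E_init G q = map_vec of_real (vec_last q (3 * npts G))"

text \<open>
  The transformed fields at time \<open>t\<close>, that is, the solutions of
  \<open>\<surd>\<mu> H_hat\<^sup>t = \<surd>\<mu> c H_hat\<^sup>0 - \<surd>\<epsilon> s E_hat\<^sup>0\<close> and
  \<open>\<surd>\<epsilon> E_hat\<^sup>t = \<surd>\<epsilon> c E_hat\<^sup>0 + \<surd>\<mu> s H_hat\<^sup>0\<close>.
\<close>

definition H_hat :: "grid3 \<Rightarrow> real \<Rightarrow> real \<Rightarrow> real \<Rightarrow> real vec \<Rightarrow> complex vec" where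
  "H_hat G \<epsilon> \<mu> t q = (let \<tau> = t / sqrt (\<mu> * \<epsilon>) in
     of_real (1 / sqrt \<mu>) \<cdot>\<^sub>v
       (of_real (sqrt \<mu>) \<cdot>\<^sub>v (c_mat G \<tau> *\<^sub>v transform3 (Dft G) (H_init G q))
        - of_real (sqrt \<epsilon>) \<cdot>\<^sub>v (s_mat G \<tau> *\<^sub>v transform3 (Dft G) (E_init G q))))"

definition E_hat :: "grid3 \<Rightarrow> real \<Rightarrow> real \<Rightarrow> real \<Rightarrow> real vec \<Rightarrow> complex vec" where
  "E_hat G \<epsilon> \<mu> t q = (let \<tau> = t / sqrt (\<mu> * \<epsilon>) in
     of_real (1 / sqrt \<epsilon>) \<cdot>\<^sub>v
       (of_real (sqrt \<epsilon>) \<cdot>\<^sub>v (c_mat G \<tau> *\<^sub>v transform3 (Dft G) (E_init G q))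
        + of_real (sqrt \<mu>) \<cdot>\<^sub>v (s_mat G \<tau> *\<^sub>v transform3 (Dft G) (H_init G q))))"

definition H_sol :: "grid3 \<Rightarrow> real \<Rightarrow> real \<Rightarrow> real \<Rightarrow> real vec \<Rightarrow> complex vec" where
  "H_sol G \<epsilon> \<mu> t q = transform3 (Inv_Dft G) (H_hat G \<epsilon> \<mu> t q)"

definition E_sol :: "grid3 \<Rightarrow> real \<Rightarrow> real \<Rightarrow> real \<Rightarrow> real vec \<Rightarrow> complex vec" where
  "E_sol G \<epsilon> \<mu> t q = transform3 (Inv_Dft G) (E_hat G \<epsilon> \<mu> t q)"

text \<open>\<open>dE\<^sub>x \<and> dH\<^sub>x + dE\<^sub>y \<and> dH\<^sub>y + dE\<^sub>z \<and> dH\<^sub>z\<close>, as a two-form in \<open>u\<close>, \<open>v\<close> at the point \<open>q\<close>.\<close>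

definition field_wedge ::
  "grid3 \<Rightarrow> (real vec \<Rightarrow> complex vec) \<Rightarrow> (real vec \<Rightarrow> complex vec) \<Rightarrow>
   real vec \<Rightarrow> real vec \<Rightarrow> real vec \<Rightarrow> complex" where
  "field_wedge G E H q u v = (let m = phase_dim G; n = npts G in
     dwedge m n (\<lambda>p. comp3 n 0 (E p)) (\<lambda>p. comp3 n 0 (H p)) q u v
     + dwedge m n (\<lambda>p. comp3 n 1 (E p)) (\<lambda>p. comp3 n 1 (H p)) q u v
     + dwedge m n (\<lambda>p. comp3 n 2 (E p)) (\<lambda>p. comp3 n 2 (H p)) q u v)"

end

theory Submission
  imports Defs "HOL-Analysis.Complex_Transcendental"
begin

text \<open>
  Write \<open>P\<close> for the inverse transform, and \<open>E\<^sub>k\<close>, \<open>H\<^sub>k\<close> for the modes of the fields.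
  These are linear in the initial values, so at tangent
  vectors \<open>u\<close>, \<open>v\<close> the two-form is \<open>\<Sum>\<^sub>k\<^sub>l (P\<^sup>T P)\<^sub>k\<^sub>l (E\<^sub>k(u) \<cdot> H\<^sub>l(v) - E\<^sub>k(v) \<cdot> H\<^sub>l(u))\<close>.
  An entry of \<open>P\<^sup>T P\<close> can be nonzero only for opposite modes \<open>l = -k\<close>, and there the frequencies
  satisfy \<open>\<Omega>(l) = -\<Omega>(k)\<close>; this uses that \<open>N/2\<close> is assigned the frequency \<open>0\<close>.
  In terms of \<open>M x = \<tau> \<Omega> \<times> x\<close> the symbols of the scheme are \<open>c = I - A M\<^sup>2\<close>, which is symmetric and even
  in \<open>\<Omega>\<close>, and \<open>s = \<i> B M\<close>, which is skew and odd in \<open>\<Omega>\<close>. They commute, and \<open>c\<^sup>2 + s\<^sup>2 = I\<close> by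
  \<open>M\<^sup>3 = -\<psi> M\<close> and \<open>2 A + \<psi> A\<^sup>2 + B\<^sup>2 = 0\<close>. Hence each pair of opposite modes contributes a conserved
  amount once the sum is symmetrised in \<open>k\<close> and \<open>l\<close>.
\<close>

section \<open>Kronecker products and diagonal matrices\<close>

lemma dim_kron [simp]:
  "dim_row (A \<otimes>\<^sub>K B) = dim_row A * dim_row B" "dim_col (A \<otimes>\<^sub>K B) = dim_col A * dim_col B"
  by (simp_all add: kron_def)

lemma mod_less_of_less_mult: "(i::nat) < a * b \<Longrightarrow> i mod b < b"
  by (cases "b = 0") auto

lemmas div_mod_less = less_mult_imp_div_less mod_less_of_less_mult

lemma index_kron:
  assumes "i < dim_row A * dim_row B" "j < dim_col A * dim_col B"
  shows "(A \<otimes>\<^sub>K B) $$ (i, j) =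
    A $$ (i div dim_row B, j div dim_col B) * B $$ (i mod dim_row B, j mod dim_col B)"
  using assms by (simp add: kron_def)

text \<open>Division with remainder by \<open>b\<close> is a bijection from
  \<open>{..<a * b}\<close> onto the pairs. It splits the inner index both of Kronecker products and
  of 3 by 3 block matrices.\<close>

lemma sum_div_mod:
  fixes f :: "nat \<Rightarrow> nat \<Rightarrow> 'a::comm_monoid_add"
  shows "(\<Sum>k<a * b. f (k div b) (k mod b)) = (\<Sum>p<a. \<Sum>q<b. f p q)"
proof -
  have lt: "p * b + q < a * b" if "p < a" "q < b" for p q
  proof -
    have "p * b + q < Suc p * b" using that by simp
    also have "\<dots> \<le> a * b" using that by (intro mult_le_mono1) simp
    finally show ?thesis .
  qed
  have "(\<Sum>p<a. \<Sum>q<b. f p q) = (\<Sum>(p, q)\<in>{..<a} \<times> {..<b}. f p q)"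
    by (simp add: sum.cartesian_product)
  also have "\<dots> = (\<Sum>k<a * b. f (k div b) (k mod b))"
    by (rule sum.reindex_bij_witness[of _ "\<lambda>k. (k div b, k mod b)" "\<lambda>(p, q). p * b + q"])
      (auto simp: lt div_mod_less)
  finally show ?thesis ..
qed

lemma index_mult_mat_sum:
  "i < dim_row A \<Longrightarrow> j < dim_col B \<Longrightarrow> dim_col A = dim_row B \<Longrightarrow>
    (A * B) $$ (i, j) = (\<Sum>k<dim_row B. A $$ (i, k) * B $$ (k, j))"
  by (simp add: scalar_prod_def atLeast0LessThan)

text \<open>The mixed-product rule: once the inner index is split into quotient and remainder, the
  sum factors. It reduces three-dimensional transforms to one-dimensional ones.\<close>

lemma kron_mult:
  fixes A B C D :: "'a::comm_semiring_1 mat"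
  assumes "dim_col A = dim_row C" "dim_col B = dim_row D"
  shows "(A \<otimes>\<^sub>K B) * (C \<otimes>\<^sub>K D) = (A * C) \<otimes>\<^sub>K (B * D)"
proof (rule eq_matI)
  fix i j assume "i < dim_row ((A * C) \<otimes>\<^sub>K (B * D))" "j < dim_col ((A * C) \<otimes>\<^sub>K (B * D))"
  then have i: "i < dim_row A * dim_row B" and j: "j < dim_col C * dim_col D" by auto
  have "((A \<otimes>\<^sub>K B) * (C \<otimes>\<^sub>K D)) $$ (i, j) =
      (\<Sum>k<dim_row C * dim_row D. (A \<otimes>\<^sub>K B) $$ (i, k) * (C \<otimes>\<^sub>K D) $$ (k, j))"
    using i j assms by (subst index_mult_mat_sum) auto
  also have "\<dots> = (\<Sum>k<dim_row C * dim_row D.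
      (A $$ (i div dim_row B, k div dim_row D) * B $$ (i mod dim_row B, k mod dim_row D)) *
      (C $$ (k div dim_row D, j div dim_col D) * D $$ (k mod dim_row D, j mod dim_col D)))"
    using i j assms by (intro sum.cong refl) (simp add: index_kron)
  also have "\<dots> = (\<Sum>p<dim_row C. \<Sum>q<dim_row D.
      (A $$ (i div dim_row B, p) * B $$ (i mod dim_row B, q)) *
      (C $$ (p, j div dim_col D) * D $$ (q, j mod dim_col D)))"
    by (rule sum_div_mod)
  also have "\<dots> = (\<Sum>p<dim_row C. A $$ (i div dim_row B, p) * C $$ (p, j div dim_col D)) *
      (\<Sum>q<dim_row D. B $$ (i mod dim_row B, q) * D $$ (q, j mod dim_col D))"
    by (simp add: sum_product mult_ac)
  also have "\<dots> = ((A * C) \<otimes>\<^sub>K (B * D)) $$ (i, j)"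
    using i j assms by (simp add: index_kron index_mult_mat_sum div_mod_less del: index_mult_mat(1))
  finally show "((A \<otimes>\<^sub>K B) * (C \<otimes>\<^sub>K D)) $$ (i, j) = ((A * C) \<otimes>\<^sub>K (B * D)) $$ (i, j)" .
qed auto

lemma transpose_kron: "transpose_mat (A \<otimes>\<^sub>K B) = transpose_mat A \<otimes>\<^sub>K transpose_mat B"
  by (rule eq_matI) (auto simp: index_kron div_mod_less)

lemma kron_mat_diag:
  fixes f g :: "nat \<Rightarrow> 'a::semiring_1"
  shows "mat_diag a f \<otimes>\<^sub>K mat_diag b g = mat_diag (a * b) (\<lambda>i. f (i div b) * g (i mod b))"
proof -
  have eq: "i = j" if "i div b = j div b" "i mod b = j mod b" for i j :: nat
    using that by (metis div_mult_mod_eq)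
  show ?thesis
    by (rule eq_matI) (auto simp: mat_diag_def index_kron div_mod_less dest: eq)
qed

lemma kron_one: "(1\<^sub>m a :: 'a::semiring_1 mat) \<otimes>\<^sub>K 1\<^sub>m b = 1\<^sub>m (a * b)"
  by (simp add: kron_mat_diag flip: mat_diag_one)

lemma smult_mat_diag: "c \<cdot>\<^sub>m mat_diag n f = mat_diag n (\<lambda>i. c * f i)"
  for c :: "'a::semiring_0"
  by (rule eq_matI) (auto simp: mat_diag_def)

lemma add_mat_diag: "mat_diag n f + mat_diag n g = mat_diag n (\<lambda>i. f i + g i)"
  for f g :: "nat \<Rightarrow> 'a::monoid_add"
  by (rule eq_matI) (auto simp: mat_diag_def)

lemma uminus_mat_diag: "- mat_diag n f = mat_diag n (\<lambda>i. - f i)"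
  for f :: "nat \<Rightarrow> 'a::group_add"
  by (rule eq_matI) (auto simp: mat_diag_def)

lemma zero_mat_diag: "0\<^sub>m n n = mat_diag n (\<lambda>i. 0)"
  by (rule eq_matI) (auto simp: mat_diag_def)

lemma square_mat_diag: "mat_diag n f ^\<^sub>m 2 = mat_diag n (\<lambda>i. (f i)\<^sup>2)"
  for f :: "nat \<Rightarrow> 'a::semiring_1"
  by (simp add: numeral_2_eq_2)

section \<open>Opposite modes of the discrete Fourier transform\<close>

text \<open>Each entry is a geometric sum over powers of an \<open>N\<close>-th root of unity, which
  equals 1 only on the diagonal because the powers of \<open>w\<close> below \<open>N\<close> are
  distinct.\<close>

lemma inv_dft_mult_dft:
  assumes N: "N > 0"
  shows "inv_dft_mat N * dft_mat N = 1\<^sub>m N"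
proof (rule eq_matI)
  fix i j assume "i < dim_row (1\<^sub>m N :: complex mat)" "j < dim_col (1\<^sub>m N :: complex mat)"
  then have ij: "i < N" "j < N" by auto
  define w :: complex where "w = exp (2 * of_real pi * \<i> / of_nat N)"
  have wn: "w \<noteq> 0" by (simp add: w_def)
  have wp: "w ^ k = exp (2 * of_real pi * \<i> * of_nat k / of_nat N)" for k
    by (simp add: w_def flip: exp_of_nat_mult) (simp add: mult_ac)
  have wN: "w ^ N = 1" using N wp[of N] by simp
  \<comment> \<open>An integer power, since \<open>i - j\<close> may be negative.\<close>
  define z where "z = w powi (int i - int j)"
  have "(inv_dft_mat N * dft_mat N) $$ (i, j) = (\<Sum>k<N. (1 / of_nat N * w ^ (i * k)) * w powi (- int (k * j)))"
    using ij by (subst index_mult_mat_sum) (auto simp: inv_dft_mat_def dft_mat_def w_def)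
  also have "\<dots> = (\<Sum>k<N. 1 / of_nat N * z ^ k)"
  proof (intro sum.cong refl)
    fix k
    have "w ^ (i * k) * w powi (- int (k * j)) = w powi (int i * int k - int k * int j)"
      using wn by (simp add: power_int_diff power_int_minus divide_inverse flip: power_int_of_nat)
    also have "int i * int k - int k * int j = (int i - int j) * int k" by (simp add: algebra_simps)
    also have "w powi \<dots> = z ^ k" by (simp add: z_def power_int_mult)
    finally show "1 / of_nat N * w ^ (i * k) * w powi (- int (k * j)) = 1 / of_nat N * z ^ k"
      by (simp add: mult.assoc)
  qed
  also have "\<dots> = 1 / of_nat N * (\<Sum>k<N. z ^ k)" by (rule sum_distrib_left[symmetric])
  also have "\<dots> = 1\<^sub>m N $$ (i, j)"
  proof (cases "i = j")
    case True then show ?thesis using ij N by (simp add: z_def)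
  next
    case False
    have "z \<noteq> 1"
    proof
      assume "z = 1"
      then have "w ^ i = w ^ j" using wn by (simp add: z_def power_int_diff)
      \<comment> \<open>The witness is the distance of \<open>i\<close> and \<open>j\<close>,
        written so that natural subtraction does not truncate.\<close>
      then have "\<exists>d. d < N \<and> d > 0 \<and> w ^ d = 1"
        using False ij wn
        by (intro exI[of _ "max i j - min i j"]) (auto simp: max_def min_def power_diff)
      then obtain d where d: "d < N" "d > 0" "w ^ d = 1" by blast
      have "N dvd d" using d wp[of d] complex_root_unity_eq_1[of N d] N by (simp add: mult_ac)
      with d show False by (auto dest: dvd_imp_le)
    qed
    moreover have "z ^ N = 1"
    proof -
      have "z ^ N = w powi (int N * (int i - int j))"
        by (simp add: z_def mult.commute flip: power_int_mult power_int_of_nat)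
      also have "\<dots> = 1" by (simp add: power_int_mult wN)
      finally show ?thesis .
    qed
    ultimately show ?thesis using False ij by (simp add: sum_gp_strict)
  qed
  finally show "(inv_dft_mat N * dft_mat N) $$ (i, j) = 1\<^sub>m N $$ (i, j)" .
qed (auto simp: inv_dft_mat_def dft_mat_def)

text \<open>The two-form is bilinear, so the transpose appears and not the adjoint. The exponents
  therefore add, and the geometric sum in \<open>w ^ (i + j)\<close> vanishes unless that root of
  unity is 1.\<close>

lemma index_transpose_inv_dft_mult:
  assumes ij: "i < N" "j < N"
    and nz: "(transpose_mat (inv_dft_mat N) * inv_dft_mat N) $$ (i, j) \<noteq> 0"
  shows "N dvd i + j"
proof (rule ccontr)
  assume nd: "\<not> N dvd i + j"
  have N: "N > 0" using ij by simp
  define w :: complex where "w = exp (2 * of_real pi * \<i> / of_nat N)"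
  have wp: "w ^ k = exp (2 * of_real pi * \<i> * of_nat k / of_nat N)" for k
    by (simp add: w_def flip: exp_of_nat_mult) (simp add: mult_ac)
  have wN: "w ^ N = 1" using N wp[of N] by simp
  define z where "z = w ^ (i + j)"
  have "(transpose_mat (inv_dft_mat N) * inv_dft_mat N) $$ (i, j)
      = (\<Sum>k<N. (1 / of_nat N * w ^ (k * i)) * (1 / of_nat N * w ^ (k * j)))"
    using ij by (subst index_mult_mat_sum) (auto simp: inv_dft_mat_def w_def)
  also have "\<dots> = (1 / of_nat N)\<^sup>2 * (\<Sum>k<N. z ^ k)"
    unfolding sum_distrib_left
    by (intro sum.cong refl)
      (simp add: z_def power2_eq_square power_add power_mult_distrib power_mult flip: power_mult, simp add: mult.commute)
  also have "(\<Sum>k<N. z ^ k) = 0"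
  proof -
    have "z \<noteq> 1" using nd wp[of "i + j"] complex_root_unity_eq_1[of N "i + j"] N
      by (simp add: z_def mult_ac)
    moreover have "z ^ N = 1" unfolding z_def power_mult[symmetric]
      by (subst mult.commute) (simp add: power_mult wN)
    ultimately show ?thesis by (simp add: sum_gp_strict)
  qed
  finally show False using nz by simp
qed

section \<open>Frequencies at opposite modes\<close>

definition freq :: "nat \<Rightarrow> real \<Rightarrow> real \<Rightarrow> nat \<Rightarrow> complex" where
  "freq N L R j = of_real (2 * pi / (R - L)) *
     (if j < N div 2 then of_nat j else if j = N div 2 then 0 else of_int (int j - int N))"

lemma freq_mat_eq: "freq_mat N L R = mat_diag N (freq N L R)"
  unfolding freq_mat_def smult_mat_diag freq_def ..

text \<open>Since \<open>i + j < 2 * N\<close>, either both indices are 0 or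
  \<open>i + j = N\<close>. In the second case one index lies below \<open>N div 2\<close> and the
  other above, or both equal \<open>N div 2\<close>; that mode is its own opposite, so oddness
  forces its frequency to be 0.\<close>

lemma freq_odd:
  assumes "even N" "i < N" "j < N" "N dvd i + j"
  shows "freq N L R i = - freq N L R j"
proof (cases "i + j = 0")
  case True
  then show ?thesis by (simp add: freq_def)
next
  case False
  obtain d where d: "i + j = N * d" using assms by blast
  have "d < 2"
  proof (rule ccontr)
    assume "\<not> d < 2"
    then have "N * 2 \<le> N * d" by (intro mult_le_mono2) simp
    then show False using d assms by linarith
  qed
  moreover have "d \<noteq> 0" using False d by auto
  ultimately have ij: "i + j = N" using d by (cases "d = 1") auto
  obtain m where m: "N = 2 * m" using assms by blast
  show ?thesis
  proof (cases "j = m")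
    case True
    then show ?thesis using ij m by (simp add: freq_def)
  next
    case False
    have "of_nat j = (of_nat N - of_nat i :: complex)"
      using ij by (metis add_diff_cancel_left' of_nat_add)
    then have odd: "(if i < m then of_nat i else if i = m then 0 else of_nat i - of_nat N :: complex)
        = - (if j < m then of_nat j else if j = m then 0 else of_nat j - of_nat N)"
      using False ij m by auto
    have eq: "freq N L R n = of_real (2 * pi / (R - L)) *
        (if n < m then of_nat n else if n = m then 0 else of_nat n - of_nat N)" for n
      by (simp add: freq_def m)
    show ?thesis unfolding eq odd by (rule mult_minus_right)
  qed
qed

text \<open>The nested \<open>div\<close> and \<open>mod\<close> follow the right-associated
  Kronecker product with x fastest. Every \<open>w\<close> above 1 is sent to the z frequency, so
  that oddness holds for all \<open>w\<close> and can be used as an equality of functions.\<close>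

definition omega :: "grid3 \<Rightarrow> nat \<Rightarrow> nat \<Rightarrow> complex" where
  "omega G k w =
     (if w = 0 then freq (Nx G) (xL G) (xR G) (k mod (Ny G * Nx G) mod Nx G)
      else if w = 1 then freq (Ny G) (yL G) (yR G) (k mod (Ny G * Nx G) div Nx G)
      else freq (Nz G) (zL G) (zR G) (k div (Ny G * Nx G)))"

lemma npts_eq: "npts G = Nz G * (Ny G * Nx G)"
  by (simp add: npts_def)

lemma Om_eq:
  "Om1 G = mat_diag (npts G) (\<lambda>k. omega G k 0)"
  "Om2 G = mat_diag (npts G) (\<lambda>k. omega G k 1)"
  "Om3 G = mat_diag (npts G) (\<lambda>k. omega G k 2)"
  unfolding Om1_def Om2_def Om3_def mat_diag_one[symmetric] freq_mat_eq kron_mat_diag npts_eq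
  by (simp_all add: omega_def)

text \<open>Transposition and the mixed-product rule turn the matrix into a Kronecker product of
  three one-dimensional ones. A nonzero entry has three nonzero factors, and each of them makes the
  indices in its direction opposite.\<close>

lemma omega_odd:
  assumes even: "even (Nx G)" "even (Ny G)" "even (Nz G)"
    and kl: "k < npts G" "l < npts G"
    and nz: "(transpose_mat (Inv_Dft G) * Inv_Dft G) $$ (k, l) \<noteq> 0"
  shows "omega G k w = - omega G l w"
proof -
  let ?R = "\<lambda>N. transpose_mat (inv_dft_mat N) * inv_dft_mat N"
  have dim: "dim_row (inv_dft_mat N) = N" "dim_col (inv_dft_mat N) = N" for N
    by (simp_all add: inv_dft_mat_def)
  have eq: "transpose_mat (Inv_Dft G) * Inv_Dft G = ?R (Nz G) \<otimes>\<^sub>K ?R (Ny G) \<otimes>\<^sub>K ?R (Nx G)"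
    by (simp add: Inv_Dft_def transpose_kron kron_mult dim)
  let ?M = "Ny G * Nx G"
  have lt: "k div ?M < Nz G" "l div ?M < Nz G" "k mod ?M < ?M" "l mod ?M < ?M"
    using kl by (auto simp: npts_eq dest: div_mod_less)
  have lt': "k mod ?M div Nx G < Ny G" "l mod ?M div Nx G < Ny G"
    "k mod ?M mod Nx G < Nx G" "l mod ?M mod Nx G < Nx G"
    using lt by (auto dest: div_mod_less)
  have "(transpose_mat (Inv_Dft G) * Inv_Dft G) $$ (k, l) = ?R (Nz G) $$ (k div ?M, l div ?M) *
      (?R (Ny G) $$ (k mod ?M div Nx G, l mod ?M div Nx G) *
       ?R (Nx G) $$ (k mod ?M mod Nx G, l mod ?M mod Nx G))"
    using kl lt unfolding eq npts_eq by (simp add: index_kron dim del: index_mult_mat(1))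
  with nz have "?R (Nz G) $$ (k div ?M, l div ?M) \<noteq> 0"
    "?R (Ny G) $$ (k mod ?M div Nx G, l mod ?M div Nx G) \<noteq> 0"
    "?R (Nx G) $$ (k mod ?M mod Nx G, l mod ?M mod Nx G) \<noteq> 0"
    by auto
  note dvd = this[THEN index_transpose_inv_dft_mult[rotated -1]]
  then show ?thesis
    using lt lt' even dvd by (simp add: omega_def freq_odd)
qed

lemma Inv_Dft_mult_Dft:
  assumes "Nx G > 0" "Ny G > 0" "Nz G > 0"
  shows "Inv_Dft G * Dft G = 1\<^sub>m (npts G)"
proof -
  have dim: "dim_row (dft_mat N) = N" "dim_col (inv_dft_mat N) = N" for N
    by (simp_all add: inv_dft_mat_def dft_mat_def)
  show ?thesis using assms
    by (simp add: Inv_Dft_def Dft_def kron_mult dim inv_dft_mult_dft kron_one npts_eq)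
qed

lemma Dft_carrier [simp]:
  "Dft G \<in> carrier_mat (npts G) (npts G)" "Inv_Dft G \<in> carrier_mat (npts G) (npts G)"
  by (auto simp: Dft_def Inv_Dft_def dft_mat_def inv_dft_mat_def npts_def)

section \<open>The symbols of the scheme\<close>

text \<open>Bilinear, without conjugation, as the two-form requires. Vectors with three components
  are functions of which only the values at 0, 1, 2 are read.\<close>

definition dot3 :: "(nat \<Rightarrow> complex) \<Rightarrow> (nat \<Rightarrow> complex) \<Rightarrow> complex" where
  "dot3 x y = x 0 * y 0 + x 1 * y 1 + x 2 * y 2"

definition cross :: "(nat \<Rightarrow> complex) \<Rightarrow> (nat \<Rightarrow> complex) \<Rightarrow> nat \<Rightarrow> complex" where
  "cross a x w = (if w = 0 then a 1 * x 2 - a 2 * x 1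
     else if w = 1 then a 2 * x 0 - a 0 * x 2
     else a 0 * x 1 - a 1 * x 0)"

definition A_coeff :: "complex \<Rightarrow> complex" where
  "A_coeff \<psi> = (if \<psi> = 0 then - 1 / 2 else (cosh (csqrt (- \<psi>)) - 1) / \<psi>)"

definition B_coeff :: "complex \<Rightarrow> complex" where
  "B_coeff \<psi> = (if \<psi> = 0 then 1 else sinh (csqrt (- \<psi>)) / csqrt (- \<psi>))"

text \<open>With \<open>r = csqrt (- \<psi>)\<close>, multiplication by \<open>\<psi>\<close> turns
  the left side into \<open>(cosh r)^2 - 1 - (sinh r)^2\<close>. At \<open>\<psi> = 0\<close> the
  values by continuity satisfy the identity directly.\<close>

lemma A_B_coeff: "2 * A_coeff \<psi> + \<psi> * (A_coeff \<psi>)\<^sup>2 + (B_coeff \<psi>)\<^sup>2 = 0"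
proof (cases "\<psi> = 0")
  case True
  then show ?thesis by (simp add: A_coeff_def B_coeff_def)
next
  case False
  define r where "r = csqrt (- \<psi>)"
  have r: "\<psi> = - r\<^sup>2" by (simp add: r_def)
  have "r \<noteq> 0" using False r by auto
  have "\<psi> * (2 * A_coeff \<psi> + \<psi> * (A_coeff \<psi>)\<^sup>2 + (B_coeff \<psi>)\<^sup>2)
      = 2 * (\<psi> * A_coeff \<psi>) + (\<psi> * A_coeff \<psi>)\<^sup>2 + \<psi> * (B_coeff \<psi>)\<^sup>2"
    by (simp add: algebra_simps power2_eq_square)
  also have "\<psi> * A_coeff \<psi> = cosh r - 1" using False by (simp add: A_coeff_def r_def)
  also have "\<psi> * (B_coeff \<psi>)\<^sup>2 = - (sinh r)\<^sup>2"
  proof -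
    have "B_coeff \<psi> = sinh r / r" using False by (simp add: B_coeff_def r_def)
    then show ?thesis using \<open>r \<noteq> 0\<close> by (simp only: r) (simp add: power_divide)
  qed
  also have "2 * (cosh r - 1) + (cosh r - 1)\<^sup>2 + - (sinh r)\<^sup>2 = 0"
    by (simp add: power2_diff cosh_square_eq)
  finally show ?thesis using False by simp
qed

definition psi :: "real \<Rightarrow> (nat \<Rightarrow> complex) \<Rightarrow> complex" where
  "psi \<tau> a = of_real (\<tau>\<^sup>2) * dot3 a a"

text \<open>Agrees with the blocks of \<open>c\<close> because \<open>cross a (cross a x)\<close> is
  \<open>dot3 a x\<close> times \<open>a\<close> minus \<open>dot3 a a\<close> times
  \<open>x\<close>.\<close>

definition c_act :: "real \<Rightarrow> (nat \<Rightarrow> complex) \<Rightarrow> (nat \<Rightarrow> complex) \<Rightarrow> nat \<Rightarrow> complex" where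
  "c_act \<tau> a x w = x w - of_real (\<tau>\<^sup>2) * A_coeff (psi \<tau> a) * cross a (cross a x) w"

definition s_act :: "real \<Rightarrow> (nat \<Rightarrow> complex) \<Rightarrow> (nat \<Rightarrow> complex) \<Rightarrow> nat \<Rightarrow> complex" where
  "s_act \<tau> a x w = \<i> * of_real \<tau> * B_coeff (psi \<tau> a) * cross a x w"

lemma dot3_comm: "dot3 x y = dot3 y x"
  by (simp add: dot3_def)

lemma dot3_add_scaled:
  "dot3 (\<lambda>w. a w + r * b w) (\<lambda>w. x w + s * y w)
    = dot3 a x + s * dot3 a y + r * dot3 b x + r * s * dot3 b y"
  by (simp add: dot3_def algebra_simps)

lemma c_act_even: "c_act \<tau> (\<lambda>w. - a w) x w = c_act \<tau> a x w"
  by (simp add: c_act_def cross_def psi_def dot3_def algebra_simps)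

lemma s_act_odd: "s_act \<tau> (\<lambda>w. - a w) x w = - s_act \<tau> a x w"
  by (simp add: s_act_def cross_def psi_def dot3_def algebra_simps)

lemma dot3_cross: "dot3 (cross a x) y = - dot3 x (cross a y)"
  by (simp add: dot3_def cross_def algebra_simps)

text \<open>\<open>cross a x\<close> is orthogonal to \<open>a\<close>, so on it the double cross
  product is multiplication by \<open>- dot3 a a\<close>.\<close>

lemma cross_cross_cross: "cross a (cross a (cross a x)) w = - dot3 a a * cross a x w"
  by (simp add: dot3_def cross_def algebra_simps)

lemma dot3_scale: "dot3 (\<lambda>w. c * a w) y = c * dot3 a y" "dot3 x (\<lambda>w. c * b w) = c * dot3 x b"
  by (simp_all add: dot3_def algebra_simps)

text \<open>The weak form of \<open>c^2 + s^2 = I\<close>, as \<open>c\<close> is symmetric and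
  \<open>s\<close> is skew. Every correction term is a multiple of \<open>p\<close>, and the total
  coefficient vanishes by \<open>A_B_coeff\<close>; the factor \<open>\<i>\<close> in
  \<open>s\<close> supplies the sign of the last term.\<close>

lemma dot3_c_act:
  "dot3 (c_act \<tau> a x) (c_act \<tau> a y) - dot3 (s_act \<tau> a x) (s_act \<tau> a y) = dot3 x y"
proof -
  define A B where "A = A_coeff (psi \<tau> a)" and "B = B_coeff (psi \<tau> a)"
  define t :: complex where "t = of_real \<tau>"
  define p where "p = dot3 (cross a x) (cross a y)"
  have p1: "dot3 x (cross a (cross a y)) = - p"
    by (simp add: p_def dot3_cross)
  have p2: "dot3 (cross a (cross a x)) y = - p"
    by (simp add: p_def dot3_cross)
  have p3: "dot3 (cross a (cross a x)) (cross a (cross a y)) = dot3 a a * p"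
    unfolding dot3_cross[of a "cross a x"] cross_cross_cross[abs_def] dot3_scale
    by (simp add: p_def)
  have c: "c_act \<tau> a z = (\<lambda>w. z w + (- t\<^sup>2 * A) * cross a (cross a z) w)" for z
    by (simp add: c_act_def A_def t_def fun_eq_iff)
  have s: "s_act \<tau> a z = (\<lambda>w. (\<i> * t * B) * cross a z w)" for z
    by (simp add: s_act_def B_def t_def fun_eq_iff)
  have "dot3 (c_act \<tau> a x) (c_act \<tau> a y) - dot3 (s_act \<tau> a x) (s_act \<tau> a y)
      = dot3 x y + (2 * t\<^sup>2 * A * p + t ^ 4 * A\<^sup>2 * dot3 a a * p + t\<^sup>2 * B\<^sup>2 * p)"
    unfolding c s dot3_add_scaled dot3_scale p1 p2 p3 p_def[symmetric]
    by (simp add: algebra_simps power2_eq_square power4_eq_xxxx)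
  also have "2 * t\<^sup>2 * A * p + t ^ 4 * A\<^sup>2 * dot3 a a * p + t\<^sup>2 * B\<^sup>2 * p
      = t\<^sup>2 * p * (2 * A + psi \<tau> a * A\<^sup>2 + B\<^sup>2)"
    by (simp add: psi_def t_def algebra_simps power2_eq_square power4_eq_xxxx)
  also have "\<dots> = 0" unfolding A_def B_def A_B_coeff by simp
  finally show ?thesis by simp
qed

text \<open>The weak form of \<open>c s = s c\<close>: both are polynomials in the cross product
  with \<open>a\<close>, so one such factor can be moved across \<open>dot3\<close> at the price of
  a sign.\<close>

lemma dot3_c_act_s_act:
  "dot3 (c_act \<tau> a x) (s_act \<tau> a y) = - dot3 (s_act \<tau> a x) (c_act \<tau> a y)"
proof -
  have e1: "dot3 (cross a (cross a x)) (cross a y) = - dot3 (cross a x) (cross a (cross a y))"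
    by (rule dot3_cross)
  have e2: "dot3 x (cross a y) = - dot3 (cross a x) y"
    by (simp add: dot3_cross)
  have e3: "dot3 (c_act \<tau> a x) (s_act \<tau> a y) = \<i> * of_real \<tau> * B_coeff (psi \<tau> a) *
      (dot3 x (cross a y) - of_real (\<tau>\<^sup>2) * A_coeff (psi \<tau> a) * dot3 (cross a (cross a x)) (cross a y))"
    by (simp add: c_act_def s_act_def dot3_def algebra_simps)
  have e4: "dot3 (s_act \<tau> a x) (c_act \<tau> a y) = \<i> * of_real \<tau> * B_coeff (psi \<tau> a) *
      (dot3 (cross a x) y - of_real (\<tau>\<^sup>2) * A_coeff (psi \<tau> a) * dot3 (cross a x) (cross a (cross a y)))"
    by (simp add: c_act_def s_act_def dot3_def algebra_simps)
  show ?thesis unfolding e3 e4 e1 e2 by (simp add: algebra_simps)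
qed

text \<open>The letters \<open>e\<close>, \<open>h\<close> belong to one tangent vector and
  \<open>f\<close>, \<open>g\<close> to the other; 1 and 2 are the opposite modes. The first product
  combines with the fourth and the second with the third: their pure terms give the initial values
  by \<open>dot3_c_act\<close>, and their mixed terms cancel because \<open>c s\<close> is skew. The
  fourth product arises from the first by exchanging tangent vectors as well as modes, hence the
  symmetrised sum.\<close>

lemma mode_pair_symplectic:
  fixes a e1 e2 h1 h2 f1 f2 g1 g2 :: "nat \<Rightarrow> complex" and \<rho> \<sigma> :: complex and \<tau> :: real
  assumes rs: "\<rho> * \<sigma> = 1" and b: "\<And>w. b w = - a w"
  defines "E \<equiv> \<lambda>a e h w. c_act \<tau> a e w + \<rho> * s_act \<tau> a h w"
    and "H \<equiv> \<lambda>a e h w. c_act \<tau> a h w - \<sigma> * s_act \<tau> a e w"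
  shows "dot3 (E a e1 h1) (H b f2 g2) + dot3 (E b e2 h2) (H a f1 g1)
      - dot3 (E a f1 g1) (H b e2 h2) - dot3 (E b f2 g2) (H a e1 h1)
    = dot3 e1 g2 + dot3 e2 g1 - dot3 f1 h2 - dot3 f2 h1"
proof -
  have b': "b = (\<lambda>w. - a w)" using b by auto
  have Eb: "E b e h = (\<lambda>w. c_act \<tau> a e w + (- \<rho>) * s_act \<tau> a h w)"
    and Hb: "H b e h = (\<lambda>w. c_act \<tau> a h w + \<sigma> * s_act \<tau> a e w)"
    and Ea: "E a e h = (\<lambda>w. c_act \<tau> a e w + \<rho> * s_act \<tau> a h w)"
    and Ha: "H a e h = (\<lambda>w. c_act \<tau> a h w + (- \<sigma>) * s_act \<tau> a e w)" for e h
    by (simp_all add: E_def H_def b' c_act_even s_act_odd fun_eq_iff)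
  have rs': "\<rho> * (\<sigma> * z) = z" for z using rs by (metis mult.assoc mult_1)
  have sc: "dot3 (s_act \<tau> a x) (c_act \<tau> a y) = dot3 (c_act \<tau> a y) (s_act \<tau> a x)" for x y
    by (rule dot3_comm)
  have skew: "dot3 (c_act \<tau> a x) (s_act \<tau> a y) = - dot3 (c_act \<tau> a y) (s_act \<tau> a x)" for x y
    by (subst dot3_c_act_s_act) (simp add: sc)
  \<comment> \<open>Fixed instances, oriented so that matching products take the same form.\<close>
  have comm: "dot3 (c_act \<tau> a f2) (c_act \<tau> a h1) = dot3 (c_act \<tau> a h1) (c_act \<tau> a f2)"
    "dot3 (c_act \<tau> a f1) (c_act \<tau> a h2) = dot3 (c_act \<tau> a h2) (c_act \<tau> a f1)"
    "dot3 (s_act \<tau> a g2) (s_act \<tau> a e1) = dot3 (s_act \<tau> a e1) (s_act \<tau> a g2)"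
    "dot3 (s_act \<tau> a g1) (s_act \<tau> a e2) = dot3 (s_act \<tau> a e2) (s_act \<tau> a g1)"
    "dot3 f1 h2 = dot3 h2 f1" "dot3 f2 h1 = dot3 h1 f2"
    by (rule dot3_comm)+
  show ?thesis
    unfolding Ea Eb Ha Hb dot3_add_scaled sc comm
      skew[of f1 e2] skew[of f2 e1] skew[of h1 g2] skew[of h2 g1]
    using dot3_c_act[of \<tau> a e1 g2] dot3_c_act[of \<tau> a e2 g1]
      dot3_c_act[of \<tau> a h2 f1] dot3_c_act[of \<tau> a h1 f2]
    by (simp add: rs rs' algebra_simps)
qed

section \<open>The two-form in terms of modes\<close>

text \<open>Linearity is asked only on the carrier, since the value at vectors of another dimension
  is left open.\<close>

definition lin_form :: "nat \<Rightarrow> (real vec \<Rightarrow> complex) \<Rightarrow> bool" where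
  "lin_form m f \<longleftrightarrow> (\<exists>a. \<forall>p\<in>carrier_vec m. f p = (\<Sum>k<m. a k * of_real (p $ k)))"

text \<open>Along each coordinate line \<open>f\<close> is affine with slope \<open>a k\<close>, so
  its differential at every point is \<open>f\<close> itself. This removes all derivatives from the
  problem.\<close>

lemma ext_deriv_lin_form:
  assumes f: "lin_form m f" and q: "q \<in> carrier_vec m" and u: "u \<in> carrier_vec m"
  shows "ext_deriv m f q u = f u"
proof -
  obtain a where a: "\<And>p. p \<in> carrier_vec m \<Longrightarrow> f p = (\<Sum>k<m. a k * of_real (p $ k))"
    using f by (auto simp: lin_form_def)
  have "partial_deriv m k f q = a k" if k: "k < m" for k
  proof -
    have "f (q + s \<cdot>\<^sub>v unit_vec m k) = f q + s *\<^sub>R a k" for s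
    proof -
      have "f (q + s \<cdot>\<^sub>v unit_vec m k)
          = (\<Sum>j<m. a j * of_real (q $ j) + (if j = k then s *\<^sub>R a k else 0))"
        using q k by (subst a) (auto intro!: sum.cong simp: algebra_simps scaleR_conv_of_real)
      then show ?thesis using q k by (simp add: sum.distrib a)
    qed
    moreover have "((\<lambda>s. f q + s *\<^sub>R a k) has_vector_derivative a k) (at 0)"
      by (auto intro!: derivative_eq_intros)
    ultimately show ?thesis by (simp add: partial_deriv_def vector_derivative_at)
  qed
  then show ?thesis using u by (simp add: ext_deriv_def a)
qed

lemma lin_form_coordinate:
  assumes "k < m"
  shows "lin_form m (\<lambda>p. of_real (p $ k))"
  unfolding lin_form_def
  by (rule exI[of _ "\<lambda>j. if j = k then 1 else 0"]) (use assms in \<open>simp add: if_distrib if_distribR sum.delta cong: if_cong\<close>)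

lemma lin_form_zero: "lin_form m (\<lambda>p. 0)"
  unfolding lin_form_def by (rule exI[of _ "\<lambda>j. 0"]) simp

lemma lin_form_add:
  assumes "lin_form m f" "lin_form m g"
  shows "lin_form m (\<lambda>p. f p + g p)"
proof -
  from assms obtain a b where
    "\<forall>p\<in>carrier_vec m. f p = (\<Sum>k<m. a k * of_real (p $ k))"
    "\<forall>p\<in>carrier_vec m. g p = (\<Sum>k<m. b k * of_real (p $ k))"
    by (auto simp: lin_form_def)
  then show ?thesis
    unfolding lin_form_def by (intro exI[of _ "\<lambda>k. a k + b k"]) (simp add: sum.distrib algebra_simps)
qed

lemma lin_form_cmult:
  assumes "lin_form m f"
  shows "lin_form m (\<lambda>p. c * f p)"
proof -
  from assms obtain a where "\<forall>p\<in>carrier_vec m. f p = (\<Sum>k<m. a k * of_real (p $ k))"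
    by (auto simp: lin_form_def)
  then show ?thesis
    unfolding lin_form_def by (intro exI[of _ "\<lambda>k. c * a k"]) (simp add: sum_distrib_left mult.assoc)
qed

lemma lin_form_diff:
  assumes "lin_form m f" "lin_form m g"
  shows "lin_form m (\<lambda>p. f p - g p)"
  using lin_form_add[OF assms(1) lin_form_cmult[OF assms(2), of "- 1"]] by simp

lemma lin_form_sum:
  assumes "\<And>i. i \<in> I \<Longrightarrow> lin_form m (f i)"
  shows "lin_form m (\<lambda>p. \<Sum>i\<in>I. f i p)"
  using assms by (induction I rule: infinite_finite_induct) (auto intro: lin_form_zero lin_form_add)

lemmas lin_form_intros = lin_form_add lin_form_diff lin_form_cmult lin_form_sum

lemma lin_form_cong:
  assumes "lin_form m g" "\<And>p. p \<in> carrier_vec m \<Longrightarrow> f p = g p"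
  shows "lin_form m f"
  using assms by (simp add: lin_form_def)

lemma lin_form_cross:
  assumes "\<And>w. w < 3 \<Longrightarrow> lin_form m (\<lambda>p. x p w)"
  shows "lin_form m (\<lambda>p. cross a (x p) w)"
  by (cases "w = 0"; cases "w = 1") (simp_all add: cross_def lin_form_intros assms)

lemma lin_form_c_act:
  assumes "\<And>w. w < 3 \<Longrightarrow> lin_form m (\<lambda>p. x p w)" "w < 3"
  shows "lin_form m (\<lambda>p. c_act \<tau> a (x p) w)"
  unfolding c_act_def by (intro lin_form_intros lin_form_cross assms)

lemma lin_form_s_act:
  assumes "\<And>w. w < 3 \<Longrightarrow> lin_form m (\<lambda>p. x p w)"
  shows "lin_form m (\<lambda>p. s_act \<tau> a (x p) w)"
  unfolding s_act_def by (intro lin_form_intros lin_form_cross assms)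

lemma index_comp3: "i < n \<Longrightarrow> comp3 n w a $ i = a $ (w * n + i)"
  by (simp add: comp3_def)

lemma sum_lessThan_3: "(\<Sum>w<3. f w) = f 0 + f 1 + f (2::nat)"
  for f :: "nat \<Rightarrow> 'a::comm_monoid_add"
  by (simp add: numeral_3_eq_3 numeral_2_eq_2)

text \<open>The modes are arbitrary linear forms, so that the same formula serves the solution and
  the initial fields. Summing over grid points first produces \<open>transpose_mat P * P\<close>;
  the factor 2 comes from adding the copy of the double sum with \<open>k\<close> and
  \<open>l\<close> exchanged.\<close>

lemma field_wedge_modes:
  fixes G :: grid3 and e h :: "real vec \<Rightarrow> nat \<Rightarrow> nat \<Rightarrow> complex"
  defines "m \<equiv> phase_dim G" and "n \<equiv> npts G"
  assumes P: "P \<in> carrier_mat n n"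
    and E: "\<And>p w i. p \<in> carrier_vec m \<Longrightarrow> w < 3 \<Longrightarrow> i < n \<Longrightarrow>
      E p $ (w * n + i) = (\<Sum>k<n. P $$ (i, k) * e p k w)"
    and H: "\<And>p w i. p \<in> carrier_vec m \<Longrightarrow> w < 3 \<Longrightarrow> i < n \<Longrightarrow>
      H p $ (w * n + i) = (\<Sum>k<n. P $$ (i, k) * h p k w)"
    and e: "\<And>k w. k < n \<Longrightarrow> w < 3 \<Longrightarrow> lin_form m (\<lambda>p. e p k w)"
    and h: "\<And>k w. k < n \<Longrightarrow> w < 3 \<Longrightarrow> lin_form m (\<lambda>p. h p k w)"
    and quv: "q \<in> carrier_vec m" "u \<in> carrier_vec m" "v \<in> carrier_vec m"
  shows "2 * field_wedge G E H q u v = (\<Sum>k<n. \<Sum>l<n. (transpose_mat P * P) $$ (k, l) *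
    (dot3 (e u k) (h v l) + dot3 (e u l) (h v k) - dot3 (e v k) (h u l) - dot3 (e v l) (h u k)))"
proof -
  let ?R = "transpose_mat P * P"
  have R: "?R $$ (k, l) = (\<Sum>i<n. P $$ (i, k) * P $$ (i, l))" if "k < n" "l < n" for k l
    using P that by (subst index_mult_mat_sum) auto
  have pair: "(\<Sum>i<n. (\<Sum>k<n. P $$ (i, k) * a k) * (\<Sum>l<n. P $$ (i, l) * b l))
      = (\<Sum>k<n. \<Sum>l<n. ?R $$ (k, l) * (a k * b l))" for a b :: "nat \<Rightarrow> complex"
  proof -
    have "(\<Sum>i<n. (\<Sum>k<n. P $$ (i, k) * a k) * (\<Sum>l<n. P $$ (i, l) * b l))
        = (\<Sum>i<n. \<Sum>k<n. \<Sum>l<n. P $$ (i, k) * P $$ (i, l) * (a k * b l))"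
      by (simp add: sum_product mult_ac)
    also have "\<dots> = (\<Sum>k<n. \<Sum>l<n. \<Sum>i<n. P $$ (i, k) * P $$ (i, l) * (a k * b l))"
      by (subst sum.swap) (intro sum.cong refl sum.swap)
    finally show ?thesis by (simp add: R flip: sum_distrib_right)
  qed
  have ext: "ext_deriv m (\<lambda>p. comp3 n w (E p) $ i) q x = (\<Sum>k<n. P $$ (i, k) * e x k w)"
    "ext_deriv m (\<lambda>p. comp3 n w (H p) $ i) q x = (\<Sum>k<n. P $$ (i, k) * h x k w)"
    if "w < 3" "i < n" "x \<in> carrier_vec m" for w i x
  proof -
    have "lin_form m (\<lambda>p. comp3 n w (E p) $ i)"
      by (rule lin_form_cong[of _ "\<lambda>p. \<Sum>k<n. P $$ (i, k) * e p k w"])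
        (use that e E in \<open>auto intro!: lin_form_intros simp: index_comp3\<close>)
    moreover have "lin_form m (\<lambda>p. comp3 n w (H p) $ i)"
      by (rule lin_form_cong[of _ "\<lambda>p. \<Sum>k<n. P $$ (i, k) * h p k w"])
        (use that h H in \<open>auto intro!: lin_form_intros simp: index_comp3\<close>)
    ultimately show "ext_deriv m (\<lambda>p. comp3 n w (E p) $ i) q x = (\<Sum>k<n. P $$ (i, k) * e x k w)"
      "ext_deriv m (\<lambda>p. comp3 n w (H p) $ i) q x = (\<Sum>k<n. P $$ (i, k) * h x k w)"
      using that quv E H by (simp_all add: ext_deriv_lin_form index_comp3)
  qed
  have dw: "dwedge m n (\<lambda>p. comp3 n w (E p)) (\<lambda>p. comp3 n w (H p)) q u v
      = (\<Sum>k<n. \<Sum>l<n. ?R $$ (k, l) * (e u k w * h v l w)) - (\<Sum>k<n. \<Sum>l<n. ?R $$ (k, l) * (e v k w * h u l w))"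
    if "w < 3" for w
    unfolding pair[symmetric] dwedge_def wedge_def
    using that quv by (simp add: ext sum_subtractf)
  have "field_wedge G E H q u v
      = (\<Sum>w<3. dwedge m n (\<lambda>p. comp3 n w (E p)) (\<lambda>p. comp3 n w (H p)) q u v)"
    by (simp add: field_wedge_def sum_lessThan_3 Let_def m_def n_def)
  also have "\<dots> = (\<Sum>k<n. \<Sum>l<n. ?R $$ (k, l) * (dot3 (e u k) (h v l) - dot3 (e v k) (h u l)))"
    by (simp add: dw sum_lessThan_3 dot3_def algebra_simps sum.distrib sum_subtractf
        del: index_mult_mat(1))
  finally have 1: "field_wedge G E H q u v
      = (\<Sum>k<n. \<Sum>l<n. ?R $$ (k, l) * (dot3 (e u k) (h v l) - dot3 (e v k) (h u l)))" .
  also have "\<dots> = (\<Sum>l<n. \<Sum>k<n. ?R $$ (k, l) * (dot3 (e u k) (h v l) - dot3 (e v k) (h u l)))"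
    by (rule sum.swap)
  \<comment> \<open>The bound indices are renamed, and \<open>?R\<close> is symmetric.\<close>
  also have "\<dots> = (\<Sum>k<n. \<Sum>l<n. ?R $$ (k, l) * (dot3 (e u l) (h v k) - dot3 (e v l) (h u k)))"
    by (intro sum.cong refl) (simp add: R mult.commute)
  finally have 2: "field_wedge G E H q u v = \<dots>" .
  have "2 * field_wedge G E H q u v = field_wedge G E H q u v + field_wedge G E H q u v" by simp
  also have "\<dots> = (\<Sum>k<n. \<Sum>l<n. ?R $$ (k, l) * (dot3 (e u k) (h v l) - dot3 (e v k) (h u l)))
      + (\<Sum>k<n. \<Sum>l<n. ?R $$ (k, l) * (dot3 (e u l) (h v k) - dot3 (e v l) (h u k)))"
    using 1 2 by metis
  finally show ?thesis
    by (simp add: algebra_simps sum.distrib sum_subtractf del: index_mult_mat(1))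
qed

section \<open>The scheme acting on Fourier modes\<close>

definition modes :: "grid3 \<Rightarrow> complex vec \<Rightarrow> nat \<Rightarrow> nat \<Rightarrow> complex" where
  "modes G a k w = (\<Sum>j<npts G. Dft G $$ (k, j) * a $ (w * npts G + j))"

lemma index3_less: "w < 3 \<Longrightarrow> i < n \<Longrightarrow> w * n + i < 3 * n" for w i n :: nat
proof -
  assume "w < 3" "i < n"
  then have "w * n + i < Suc w * n" by simp
  also have "\<dots> \<le> 3 * n" using \<open>w < 3\<close> by (intro mult_le_mono1) simp
  finally show ?thesis .
qed

lemma index_mult_mat_vec_sum:
  "i < dim_row A \<Longrightarrow> (A *\<^sub>v a) $ i = (\<Sum>j<dim_vec a. A $$ (i, j) * a $ j)" if "dim_col A = dim_vec a"
  using that by (simp add: scalar_prod_def atLeast0LessThan)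

lemma index_transform3:
  assumes F: "F \<in> carrier_mat n n" and "w < 3" "i < n"
  shows "transform3 F a $ (w * n + i) = (\<Sum>j<n. F $$ (i, j) * a $ (w * n + j))"
proof -
  have "transform3 F a $ (w * n + i) = (F *\<^sub>v comp3 n w a) $ i"
  proof -
    consider "w = 0" | "w = 1" | "w = 2" using \<open>w < 3\<close> by linarith
    then show ?thesis
      using F \<open>i < n\<close> by cases (simp_all add: transform3_def stack3_def Let_def)
  qed
  also have "\<dots> = (\<Sum>j<n. F $$ (i, j) * a $ (w * n + j))"
    using F \<open>i < n\<close> by (subst index_mult_mat_vec_sum) (auto simp: comp3_def)
  finally show ?thesis .
qed

lemma transform3_carrier: "F \<in> carrier_mat n n \<Longrightarrow> transform3 F a \<in> carrier_vec (3 * n)"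
  by (intro carrier_vecI) (simp add: transform3_def stack3_def Let_def)

text \<open>Diagonal blocks decouple the modes: of each block only the entry at offset
  \<open>i\<close> survives, which leaves a 3 by 3 system for every mode.\<close>

lemma index_block_mat3_mult_vec:
  assumes a: "a \<in> carrier_vec (3 * n)" and wi: "w < 3" "i < n"
    and M: "\<And>w'. w' < 3 \<Longrightarrow> M ! w ! w' = mat_diag n (D w')"
  shows "(block_mat3 n M *\<^sub>v a) $ (w * n + i) = (\<Sum>w'<3. D w' i * a $ (w' * n + i))"
proof -
  have "(block_mat3 n M *\<^sub>v a) $ (w * n + i)
      = (\<Sum>j<3 * n. (M ! w ! (j div n)) $$ (i, j mod n) * a $ (j div n * n + j mod n))"
    using a wi index3_less[OF wi] by (subst index_mult_mat_vec_sum) (auto simp: block_mat3_def)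
  also have "\<dots> = (\<Sum>w'<3. \<Sum>j<n. (M ! w ! w') $$ (i, j) * a $ (w' * n + j))"
    by (rule sum_div_mod)
  also have "\<dots> = (\<Sum>w'<3. \<Sum>j<n. if j = i then D w' i * a $ (w' * n + i) else 0)"
    using wi by (intro sum.cong refl) (auto simp: M mat_diag_def)
  finally show ?thesis using wi by simp
qed

lemma A_B_mat_eq:
  "A_mat G \<tau> = mat_diag (npts G) (\<lambda>k. A_coeff (psi \<tau> (omega G k)))"
  "B_mat G \<tau> = mat_diag (npts G) (\<lambda>k. B_coeff (psi \<tau> (omega G k)))"
proof -
  have "Psi G \<tau> = mat_diag (npts G) (\<lambda>k. psi \<tau> (omega G k))"
    by (simp add: Psi_def Om_eq square_mat_diag add_mat_diag smult_mat_diag psi_def dot3_def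
      power2_eq_square)
  then show "A_mat G \<tau> = mat_diag (npts G) (\<lambda>k. A_coeff (psi \<tau> (omega G k)))"
    "B_mat G \<tau> = mat_diag (npts G) (\<lambda>k. B_coeff (psi \<tau> (omega G k)))"
    by (auto intro!: eq_matI simp: A_mat_def B_mat_def A_coeff_def B_coeff_def mat_diag_def Let_def)
qed

lemmas mat_diag_arith = Om_eq A_B_mat_eq square_mat_diag add_mat_diag smult_mat_diag
  uminus_mat_diag zero_mat_diag

lemma index_c_mat_mult_vec:
  assumes a: "a \<in> carrier_vec (3 * npts G)" and w: "w < 3" and k: "k < npts G"
  shows "(c_mat G \<tau> *\<^sub>v a) $ (w * npts G + k)
    = c_act \<tau> (omega G k) (\<lambda>w. a $ (w * npts G + k)) w"
proof -
  \<comment> \<open>The entries of \<open>c\<close> with the double cross product expanded; on the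
    diagonal, \<open>dot3\<close> minus one square leaves the other two squares.\<close>
  define D where "D = (\<lambda>w w' k. (if w = w' then 1 else 0) + of_real (\<tau>\<^sup>2) *
    ((if w = w' then dot3 (omega G k) (omega G k) else 0) - omega G k w * omega G k w') *
     A_coeff (psi \<tau> (omega G k)))"
  have "(c_mat G \<tau> *\<^sub>v a) $ (w * npts G + k) = (\<Sum>w'<3. D w w' k * a $ (w' * npts G + k))"
    unfolding c_mat_def
  proof (rule index_block_mat3_mult_vec[OF a w k])
    fix w' :: nat assume w': "w' < 3"
    have cases3: "v = 0 \<or> v = 1 \<or> v = 2" if "v < 3" for v :: nat using that by linarith
    show "[[c11 G \<tau>, c12 G \<tau>, c13 G \<tau>], [c12 G \<tau>, c22 G \<tau>, c23 G \<tau>],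
        [c13 G \<tau>, c23 G \<tau>, c33 G \<tau>]] ! w ! w' = mat_diag (npts G) (D w w')"
      using cases3[OF w] cases3[OF w']
      by (elim disjE) (simp_all add: c11_def c12_def c13_def c22_def c23_def c33_def
        mat_diag_arith D_def dot3_def fun_eq_iff power2_eq_square algebra_simps
        flip: mat_diag_one)
  qed
  also have "\<dots> = c_act \<tau> (omega G k) (\<lambda>w. a $ (w * npts G + k)) w"
  proof -
    consider "w = 0" | "w = 1" | "w = 2" using w by linarith
    then show ?thesis
      by cases (simp_all add: c_act_def cross_def dot3_def D_def sum_lessThan_3 algebra_simps)
  qed
  finally show ?thesis .
qed

lemma index_s_mat_mult_vec:
  assumes a: "a \<in> carrier_vec (3 * npts G)" and w: "w < 3" and k: "k < npts G"
  shows "(s_mat G \<tau> *\<^sub>v a) $ (w * npts G + k)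
    = s_act \<tau> (omega G k) (\<lambda>w. a $ (w * npts G + k)) w"
proof -
  \<comment> \<open>Column \<open>w'\<close> of the matrix of a cross product is its value at the
    unit vector \<open>w'\<close>.\<close>
  define D where "D = (\<lambda>w w' k. \<i> * of_real \<tau> * B_coeff (psi \<tau> (omega G k)) *
    cross (omega G k) (\<lambda>v. if v = w' then 1 else 0) w)"
  have "(s_mat G \<tau> *\<^sub>v a) $ (w * npts G + k) = (\<Sum>w'<3. D w w' k * a $ (w' * npts G + k))"
    unfolding s_mat_def Let_def
  proof (rule index_block_mat3_mult_vec[OF a w k])
    fix w' :: nat assume w': "w' < 3"
    have cases3: "v = 0 \<or> v = 1 \<or> v = 2" if "v < 3" for v :: nat using that by linarith
    show "[[0\<^sub>m (npts G) (npts G), - s12 G \<tau>, s13 G \<tau>],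
        [s12 G \<tau>, 0\<^sub>m (npts G) (npts G), - s23 G \<tau>],
        [- s13 G \<tau>, s23 G \<tau>, 0\<^sub>m (npts G) (npts G)]] ! w ! w' = mat_diag (npts G) (D w w')"
      using cases3[OF w] cases3[OF w']
      by (elim disjE) (simp_all add: s12_def s13_def s23_def
        mat_diag_arith D_def cross_def fun_eq_iff algebra_simps)
  qed
  also have "\<dots> = s_act \<tau> (omega G k) (\<lambda>w. a $ (w * npts G + k)) w"
  proof -
    consider "w = 0" | "w = 1" | "w = 2" using w by linarith
    then show ?thesis
      by cases (simp_all add: s_act_def cross_def D_def sum_lessThan_3 algebra_simps)
  qed
  finally show ?thesis .
qed

lemma index_init:
  assumes "p \<in> carrier_vec (phase_dim G)" "w < 3" "i < npts G"
  shows "H_init G p $ (w * npts G + i) = of_real (p $ (w * npts G + i))"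
    "E_init G p $ (w * npts G + i) = of_real (p $ (3 * npts G + (w * npts G + i)))"
  using assms index3_less[of w i "npts G"]
  by (simp_all add: H_init_def E_init_def vec_first_def vec_last_def phase_dim_def)

lemma lin_form_modes_init:
  assumes "w < 3"
  shows "lin_form (phase_dim G) (\<lambda>p. modes G (H_init G p) k w)"
    "lin_form (phase_dim G) (\<lambda>p. modes G (E_init G p) k w)"
proof -
  have "lin_form (phase_dim G) (\<lambda>p. H_init G p $ (w * npts G + j))"
    "lin_form (phase_dim G) (\<lambda>p. E_init G p $ (w * npts G + j))" if "j < npts G" for j
    using assms that index3_less[OF assms that]
    by (auto intro!: lin_form_cong[OF lin_form_coordinate] simp: index_init phase_dim_def)
  then show "lin_form (phase_dim G) (\<lambda>p. modes G (H_init G p) k w)"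
    "lin_form (phase_dim G) (\<lambda>p. modes G (E_init G p) k w)"
    unfolding modes_def by (auto intro!: lin_form_intros)
qed

text \<open>Fourier inversion presents the initial fields in the form that
  \<open>field_wedge_modes\<close> asks for.\<close>

lemma Inv_Dft_modes:
  assumes "Nx G > 0" "Ny G > 0" "Nz G > 0" and i: "i < npts G"
  shows "(\<Sum>k<npts G. Inv_Dft G $$ (i, k) * modes G a k w) = a $ (w * npts G + i)"
proof -
  let ?n = "npts G"
  have "(\<Sum>k<?n. Inv_Dft G $$ (i, k) * modes G a k w)
      = (\<Sum>j<?n. \<Sum>k<?n. Inv_Dft G $$ (i, k) * Dft G $$ (k, j) * a $ (w * ?n + j))"
    unfolding modes_def sum_distrib_left by (subst sum.swap) (simp add: mult.assoc)
  also have "\<dots> = (\<Sum>j<?n. (Inv_Dft G * Dft G) $$ (i, j) * a $ (w * ?n + j))"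
    unfolding sum_distrib_right[symmetric]
    using i by (intro sum.cong refl)
      (subst index_mult_mat_sum; simp add: carrier_matD[OF Dft_carrier(1)] carrier_matD[OF Dft_carrier(2)])
  also have "\<dots> = (\<Sum>j<?n. if j = i then a $ (w * ?n + i) else 0)"
    using i by (intro sum.cong refl) (auto simp: Inv_Dft_mult_Dft assms simp del: index_mult_mat(1))
  finally show ?thesis using i by simp
qed

lemma index_hat:
  fixes \<epsilon> \<mu> t :: real and G :: grid3
  assumes "\<epsilon> > 0" "\<mu> > 0" and w: "w < 3" and k: "k < npts G"
  defines "\<tau> \<equiv> t / sqrt (\<mu> * \<epsilon>)"
  shows "E_hat G \<epsilon> \<mu> t p $ (w * npts G + k) =
      c_act \<tau> (omega G k) (modes G (E_init G p) k) w +
      of_real (sqrt \<mu> / sqrt \<epsilon>) * s_act \<tau> (omega G k) (modes G (H_init G p) k) w" (is ?E)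
    and "H_hat G \<epsilon> \<mu> t p $ (w * npts G + k) =
      c_act \<tau> (omega G k) (modes G (H_init G p) k) w -
      of_real (sqrt \<epsilon> / sqrt \<mu>) * s_act \<tau> (omega G k) (modes G (E_init G p) k) w" (is ?H)
proof -
  let ?n = "npts G"
  have act: "(c_mat G \<tau> *\<^sub>v transform3 (Dft G) a) $ (w * ?n + k) = c_act \<tau> (omega G k) (modes G a k) w"
    "(s_mat G \<tau> *\<^sub>v transform3 (Dft G) a) $ (w * ?n + k) = s_act \<tau> (omega G k) (modes G a k) w" for a
  proof -
    have tr: "transform3 (Dft G) a $ (v * ?n + k) = modes G a k v" if "v < 3" for v
      using that k by (simp add: index_transform3[of _ ?n] modes_def)
    \<comment> \<open>The arguments agree only below 3, so the symbols are unfolded to the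
      components that they read.\<close>
    have "c_act \<tau> (omega G k) (\<lambda>v. transform3 (Dft G) a $ (v * ?n + k)) w = c_act \<tau> (omega G k) (modes G a k) w"
      "s_act \<tau> (omega G k) (\<lambda>v. transform3 (Dft G) a $ (v * ?n + k)) w = s_act \<tau> (omega G k) (modes G a k) w"
      unfolding c_act_def s_act_def cross_def using tr[OF w] tr[of 0] tr[of 1] tr[of 2] by simp_all
    then show "(c_mat G \<tau> *\<^sub>v transform3 (Dft G) a) $ (w * ?n + k) = c_act \<tau> (omega G k) (modes G a k) w"
      "(s_mat G \<tau> *\<^sub>v transform3 (Dft G) a) $ (w * ?n + k) = s_act \<tau> (omega G k) (modes G a k) w"
      using w k by (simp_all add: index_c_mat_mult_vec index_s_mat_mult_vec transform3_carrier[of _ ?n])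
  qed
  have dim: "dim_row (c_mat G \<tau>) = 3 * ?n" "dim_row (s_mat G \<tau>) = 3 * ?n"
    by (simp_all add: c_mat_def s_mat_def block_mat3_def Let_def)
  show ?E ?H
    using index3_less[OF w k] assms(1,2) unfolding E_hat_def H_hat_def Let_def \<tau>_def[symmetric]
    by (simp_all add: dim act distrib_left right_diff_distrib del: index_mult_mat_vec)
qed

theorem theorem4p5:
  fixes G :: grid3 and \<epsilon> \<mu> t_end :: real and q u v :: "real vec"
  assumes "\<epsilon> > 0" and "\<mu> > 0" and "t_end \<ge> 0"
    and "xL G < xR G" and "yL G < yR G" and "zL G < zR G"
    and "Nx G > 0" and "even (Nx G)"
    and "Ny G > 0" and "even (Ny G)"
    and "Nz G > 0" and "even (Nz G)"
    and "q \<in> carrier_vec (phase_dim G)"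
    and "u \<in> carrier_vec (phase_dim G)" and "v \<in> carrier_vec (phase_dim G)"
  shows "field_wedge G (E_sol G \<epsilon> \<mu> t_end) (H_sol G \<epsilon> \<mu> t_end) q u v
       = field_wedge G (E_init G) (H_init G) q u v"
proof -
  let ?n = "npts G" and ?P = "Inv_Dft G"
  define \<tau> where "\<tau> = t_end / sqrt (\<mu> * \<epsilon>)"
  \<comment> \<open>The ratios left after dividing out the square roots in the scheme; they are
    reciprocal.\<close>
  define \<rho> \<sigma> :: complex where "\<rho> = of_real (sqrt \<mu> / sqrt \<epsilon>)" and "\<sigma> = of_real (sqrt \<epsilon> / sqrt \<mu>)"
  have \<rho>\<sigma>: "\<rho> * \<sigma> = 1"
    using assms(1,2) by (simp add: \<rho>_def \<sigma>_def flip: of_real_mult)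
  define e0 h0 where "e0 = (\<lambda>p. modes G (E_init G p))" and "h0 = (\<lambda>p. modes G (H_init G p))"
  define e where "e = (\<lambda>p k w. c_act \<tau> (omega G k) (e0 p k) w + \<rho> * s_act \<tau> (omega G k) (h0 p k) w)"
  define h where "h = (\<lambda>p k w. c_act \<tau> (omega G k) (h0 p k) w - \<sigma> * s_act \<tau> (omega G k) (e0 p k) w)"
  have lin0: "lin_form (phase_dim G) (\<lambda>p. e0 p k w)" "lin_form (phase_dim G) (\<lambda>p. h0 p k w)"
    if "w < 3" for k w
    using that by (simp_all add: e0_def h0_def lin_form_modes_init)
  have "2 * field_wedge G (E_sol G \<epsilon> \<mu> t_end) (H_sol G \<epsilon> \<mu> t_end) q u v
      = (\<Sum>k<?n. \<Sum>l<?n. (transpose_mat ?P * ?P) $$ (k, l) *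
        (dot3 (e u k) (h v l) + dot3 (e u l) (h v k) - dot3 (e v k) (h u l) - dot3 (e v l) (h u k)))"
  proof (rule field_wedge_modes)
    show "E_sol G \<epsilon> \<mu> t_end p $ (w * ?n + i) = (\<Sum>k<?n. ?P $$ (i, k) * e p k w)"
      "H_sol G \<epsilon> \<mu> t_end p $ (w * ?n + i) = (\<Sum>k<?n. ?P $$ (i, k) * h p k w)"
      if "w < 3" "i < ?n" for p w i
      using that assms(1,2)
      by (simp_all add: E_sol_def H_sol_def index_transform3[of _ ?n] index_hat e_def h_def
          e0_def h0_def \<tau>_def \<rho>_def \<sigma>_def)
    show "lin_form (phase_dim G) (\<lambda>p. e p k w)" "lin_form (phase_dim G) (\<lambda>p. h p k w)"
      if "w < 3" for k w
      unfolding e_def h_def by (intro lin_form_intros lin_form_c_act lin_form_s_act lin0 that; assumption)+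
  qed (use assms in simp_all)
  also have "\<dots> = (\<Sum>k<?n. \<Sum>l<?n. (transpose_mat ?P * ?P) $$ (k, l) *
        (dot3 (e0 u k) (h0 v l) + dot3 (e0 u l) (h0 v k) - dot3 (e0 v k) (h0 u l) - dot3 (e0 v l) (h0 u k)))"
  proof (intro sum.cong refl)
    fix k l assume "k \<in> {..<?n}" "l \<in> {..<?n}"
    then have kl: "k < ?n" "l < ?n" by auto
    show "(transpose_mat ?P * ?P) $$ (k, l) *
        (dot3 (e u k) (h v l) + dot3 (e u l) (h v k) - dot3 (e v k) (h u l) - dot3 (e v l) (h u k))
      = (transpose_mat ?P * ?P) $$ (k, l) *
        (dot3 (e0 u k) (h0 v l) + dot3 (e0 u l) (h0 v k) - dot3 (e0 v k) (h0 u l) - dot3 (e0 v l) (h0 u k))"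
    \<comment> \<open>A zero weight makes both sides 0; any other weight means opposite
      modes.\<close>
    proof (cases "(transpose_mat ?P * ?P) $$ (k, l) = 0")
      case False
      have "omega G l w = - omega G k w" for w
        using omega_odd[OF _ _ _ kl False, of w] assms by simp
      then show ?thesis
        unfolding e_def h_def by (subst mode_pair_symplectic[OF \<rho>\<sigma>]) auto
    qed (simp del: index_mult_mat(1))
  qed
  \<comment> \<open>The same formula read backwards, with the initial fields synthesised from their
    own modes.\<close>
  also have "\<dots> = 2 * field_wedge G (E_init G) (H_init G) q u v"
    by (rule field_wedge_modes[symmetric])
      (use assms lin0 in \<open>simp_all add: Inv_Dft_modes e0_def h0_def\<close>)
  finally show ?thesis by simp
qed

end
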